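(* Let $\{X_t: t\ge0\}$ be an irreducible continuous-time Markov process on a countable state space $E$ which admits a stationary measure $\mu$. If the Markov process $\{X^s_t:t\ge0\}$ is transient, then $\{X_t:t\ge 0\}$ is transient.
   Context: $X_t$ has jump rates $r(x,y)$ ($x\ne y$) and holding rates $\lambda(x)=\sum_y r(x,y)$, with paths in the space of right-continuous functions with left limits $D(\mathbb R_+,E)$. The stationary measure $\mu$ (not necessarily finite, $\mu(x)>0$) satisfies $\sum_y\mu(y)r(y,x)=\mu(x)\lambda(x)$. The adjoint rates $r^*(x,y)$ are defined by $\mu(x)r(x,y)=\mu(y)r^*(y,x)$. $X^s_t$, the symmetric (reversible) version of $X_t$, is the Markov process with jump rates $\frac12\{r(x,y)+r^*(x,y)\}$, i.e. with generator $S=\frac12(L+L^* )$, where $L,L^*$ are the generators of $X_t$ and of its adjoint with respect to $\mu$. *)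

theory Defs
  imports "HOL-Probability.Probability"
begin

definition jump_rates :: "('e::countable \<Rightarrow> 'e \<Rightarrow> real) \<Rightarrow> bool" where
  "jump_rates r \<longleftrightarrow>
     (\<forall>x y. 0 \<le> r x y) \<and> (\<forall>x. r x x = 0) \<and> (\<forall>x. (\<lambda>y. r x y) summable_on UNIV)"

definition holding_rate :: "('e::countable \<Rightarrow> 'e \<Rightarrow> real) \<Rightarrow> 'e \<Rightarrow> real" where
  "holding_rate r x = (\<Sum>\<^sub>\<infinity>y. r x y)"

text \<open>The case \<open>holding_rate r x = 0\<close> (\<open>x\<close> absorbing) is the usual convention for the jump chain;
  the holding time at \<open>x\<close> is then infinite, so the value plays no role for the process.\<close>

definition jump_prob :: "('e::countable \<Rightarrow> 'e \<Rightarrow> real) \<Rightarrow> 'e \<Rightarrow> 'e \<Rightarrow> real" where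
  "jump_prob r x y =
     (if holding_rate r x = 0 then of_bool (x = y) else r x y / holding_rate r x)"

definition irreducible_rates :: "('e::countable \<Rightarrow> 'e \<Rightarrow> real) \<Rightarrow> bool" where
  "irreducible_rates r \<longleftrightarrow> (\<forall>x y. (\<lambda>a b. 0 < r a b)\<^sup>*\<^sup>* x y)"

definition stationary_measure :: "('e::countable \<Rightarrow> 'e \<Rightarrow> real) \<Rightarrow> ('e \<Rightarrow> real) \<Rightarrow> bool" where
  "stationary_measure r \<mu> \<longleftrightarrow>
     (\<forall>x. 0 < \<mu> x) \<and>
     (\<forall>x. ((\<lambda>y. \<mu> y * r y x) has_sum (\<mu> x * holding_rate r x)) UNIV)"

definition adjoint_rate :: "('e::countable \<Rightarrow> real) \<Rightarrow> ('e \<Rightarrow> 'e \<Rightarrow> real) \<Rightarrow> 'e \<Rightarrow> 'e \<Rightarrow> real" where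
  "adjoint_rate \<mu> r y x = \<mu> x * r x y / \<mu> y"

lemma adjoint_rate_iff:
  assumes "\<forall>x. 0 < \<mu> x"
  shows "(\<forall>x y. \<mu> x * r x y = \<mu> y * r' y x) \<longleftrightarrow> r' = adjoint_rate \<mu> r"
proof -
  have "\<mu> y \<noteq> 0" for y
    using assms by (metis less_irrefl)
  then show ?thesis
    by (auto simp: adjoint_rate_def fun_eq_iff field_simps)
qed

definition symmetric_rate :: "('e::countable \<Rightarrow> real) \<Rightarrow> ('e \<Rightarrow> 'e \<Rightarrow> real) \<Rightarrow> 'e \<Rightarrow> 'e \<Rightarrow> real" where
  "symmetric_rate \<mu> r x y = (r x y + adjoint_rate \<mu> r x y) / 2"

text \<open>\<open>markov_from r x M X\<close>: on the probability space \<open>M\<close>, \<open>X\<close> is the (minimal) continuous-time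
  Markov process with jump rates \<open>r\<close> started at \<open>x\<close>.  Here \<open>Y\<close> is the sequence of visited states
  and \<open>S\<close> the sequence of holding times, so that \<open>\<Sum>i<n. S i\<close> is the time of the \<open>n\<close>-th jump.
  The displayed joint law says that \<open>Y\<close> is a Markov chain from \<open>x\<close> with transition probabilities
  \<open>jump_prob r\<close> and that, given \<open>Y\<close>, the holding times are independent, \<open>S i\<close> being exponential
  with parameter \<open>holding_rate r (Y i)\<close> (infinite when this parameter is 0).
  The value \<open>None\<close> is the cemetery, occupied from the explosion time on.\<close>

definition markov_from ::
    "('e::countable \<Rightarrow> 'e \<Rightarrow> real) \<Rightarrow> 'e \<Rightarrow> 'w measure \<Rightarrow> (real \<Rightarrow> 'w \<Rightarrow> 'e option) \<Rightarrow> bool" where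
  "markov_from r x M X \<longleftrightarrow> prob_space M \<and>
     (\<exists>(Y :: nat \<Rightarrow> 'w \<Rightarrow> 'e) (S :: nat \<Rightarrow> 'w \<Rightarrow> ennreal).
        (\<forall>n. Y n \<in> measurable M (count_space UNIV)) \<and>
        (\<forall>n. S n \<in> borel_measurable M) \<and>
        (\<forall>n. \<forall>\<omega>\<in>space M. 0 < S n \<omega>) \<and>
        (\<forall>n (y :: nat \<Rightarrow> 'e) (s :: nat \<Rightarrow> real). (\<forall>i. 0 \<le> s i) \<longrightarrow>
           measure M {\<omega> \<in> space M. \<forall>i\<le>n. Y i \<omega> = y i \<and> ennreal (s i) < S i \<omega>} =
             of_bool (y 0 = x) * (\<Prod>i<n. jump_prob r (y i) (y (Suc i)))
               * (\<Prod>i\<le>n. exp (- holding_rate r (y i) * s i))) \<and>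
        (\<forall>\<omega>\<in>space M. \<forall>t\<ge>0.
           (\<forall>n. (\<Sum>i<n. S i \<omega>) \<le> ennreal t \<and> ennreal t < (\<Sum>i<Suc n. S i \<omega>)
              \<longrightarrow> X t \<omega> = Some (Y n \<omega>)) \<and>
           ((\<forall>n. (\<Sum>i<n. S i \<omega>) \<le> ennreal t) \<longrightarrow> X t \<omega> = None)))"

definition markov_process ::
    "('e::countable \<Rightarrow> 'e \<Rightarrow> real) \<Rightarrow> ('e \<Rightarrow> 'w measure) \<Rightarrow> (real \<Rightarrow> 'w \<Rightarrow> 'e option) \<Rightarrow> bool" where
  "markov_process r P X \<longleftrightarrow> (\<forall>x. markov_from r x (P x) X)"

text \<open>For a process with \<open>markov_process r P X\<close> this says that almost all paths are in
  \<open>D(\<real>\<^sub>+, E)\<close>: before explosion paths are right-continuous step functions, and they have left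
  limits in \<open>E\<close> at all times exactly when the jump times do not accumulate.\<close>

definition non_explosive :: "('e \<Rightarrow> 'w measure) \<Rightarrow> (real \<Rightarrow> 'w \<Rightarrow> 'e option) \<Rightarrow> bool" where
  "non_explosive P X \<longleftrightarrow> (\<forall>x. AE \<omega> in P x. \<forall>t\<ge>0. X t \<omega> \<noteq> None)"

definition return_time :: "(real \<Rightarrow> 'e option) \<Rightarrow> 'e \<Rightarrow> ennreal" where
  "return_time p x =
     Inf (ennreal ` {t. 0 < t \<and> p t = Some x \<and> (\<exists>s. 0 < s \<and> s < t \<and> p s \<noteq> Some x)})"

text \<open>Under \<open>P x\<close>, when \<open>x\<close> is not absorbing the path leaves \<open>x\<close> almost surely and the first
  conjunct is redundant; it makes an absorbing state recurrent rather than transient.\<close>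

definition transient :: "('e \<Rightarrow> 'w measure) \<Rightarrow> (real \<Rightarrow> 'w \<Rightarrow> 'e option) \<Rightarrow> bool" where
  "transient P X \<longleftrightarrow>
     (\<forall>x. 0 < measure (P x) {\<omega> \<in> space (P x).
            (\<exists>t\<ge>0. X t \<omega> \<noteq> Some x) \<and> return_time (\<lambda>t. X t \<omega>) x = \<infinity>})"

end

theory Submission
  imports Defs
begin

text \<open>
  Whether the path returns to its starting point \<open>x\<close> is decided by the embedded jump chain.  For a
  finite set \<open>F\<close> containing \<open>x\<close>, let \<open>h\<close> and \<open>k\<close> be the probabilities of hitting \<open>x\<close> before leaving
  \<open>F\<close> for the chain and for its symmetric version, and \<open>e\<close>, \<open>e\<^sub>s\<close> the corresponding probabilities of
  leaving \<open>F\<close> before returning to \<open>x\<close>.  With the Dirichlet form \<open>E(f, g) = - \<Sum>y\<in>F. \<mu> y * f y * (L g) y\<close>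
  (functions vanishing off \<open>F\<close>), whose symmetric part is the form \<open>E\<^sub>s\<close> of the symmetric version, and
  \<open>c = \<mu> x * holding_rate r x\<close>, harmonicity off \<open>x\<close> gives \<open>E(h, h) = c * e\<close> and
  \<open>E\<^sub>s(h, k) = E\<^sub>s(k, k) = c * e\<^sub>s\<close>.  Hence
  \<open>0 \<le> E(h - k, h - k) = E(h, h) - 2 * E\<^sub>s(h, k) + E\<^sub>s(k, k) = c * (e - e\<^sub>s)\<close>;
  exhausting the state space by finite sets, the escape probability of the chain is at least that of
  its symmetric version.
\<close>

section \<open>Comparison of escape probabilities\<close>

text \<open>The bound \<open>g y * g z \<le> (g y)\<^sup>2 / 2 + (g z)\<^sup>2 / 2\<close> splits
  the double sum into two halves: row sums of \<open>a\<close> control one, column sums the other.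
  Asymmetric kernels are thus covered.\<close>

lemma dirichlet_form_nonneg:
  fixes a :: "'e \<Rightarrow> 'e \<Rightarrow> real" and d g :: "'e \<Rightarrow> real"
  assumes nonneg: "\<And>y z. 0 \<le> a y z"
    and row: "\<And>y. y \<in> F \<Longrightarrow> (\<Sum>z\<in>F. a y z) \<le> d y"
    and col: "\<And>z. z \<in> F \<Longrightarrow> (\<Sum>y\<in>F. a y z) \<le> d z"
  shows "(\<Sum>y\<in>F. \<Sum>z\<in>F. a y z * (g y * g z)) \<le> (\<Sum>y\<in>F. d y * (g y)\<^sup>2)"
proof -
  have "a y z * (g y * g z) \<le> a y z * (g y)\<^sup>2 / 2 + a y z * (g z)\<^sup>2 / 2" for y z
  proof -
    have "g y * g z \<le> (g y)\<^sup>2 / 2 + (g z)\<^sup>2 / 2"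
      using sum_squares_bound[of "g y" "g z"] by simp
    from mult_left_mono[OF this nonneg[of y z]] show ?thesis
      by (simp add: algebra_simps)
  qed
  then have "(\<Sum>y\<in>F. \<Sum>z\<in>F. a y z * (g y * g z))
      \<le> (\<Sum>y\<in>F. \<Sum>z\<in>F. a y z * (g y)\<^sup>2 / 2 + a y z * (g z)\<^sup>2 / 2)"
    by (intro sum_mono) auto
  also have "\<dots> = (\<Sum>y\<in>F. \<Sum>z\<in>F. a y z * (g y)\<^sup>2 / 2) + (\<Sum>z\<in>F. \<Sum>y\<in>F. a y z * (g z)\<^sup>2 / 2)"
    by (subst (3) sum.swap) (simp add: sum.distrib)
  also have "\<dots> = (\<Sum>y\<in>F. (\<Sum>z\<in>F. a y z) * (g y)\<^sup>2 / 2) + (\<Sum>z\<in>F. (\<Sum>y\<in>F. a y z) * (g z)\<^sup>2 / 2)"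
    by (simp add: sum_distrib_right sum_divide_distrib)
  also have "\<dots> \<le> (\<Sum>y\<in>F. d y * (g y)\<^sup>2 / 2) + (\<Sum>z\<in>F. d z * (g z)\<^sup>2 / 2)"
    by (intro add_mono sum_mono divide_right_mono mult_right_mono row col) auto
  finally show ?thesis
    by (simp flip: sum_divide_distrib)
qed

text \<open>In the application \<open>a y z = \<mu> y * r y z\<close>,
  \<open>d y = \<mu> y * holding_rate r y\<close>, and \<open>h\<close>, \<open>k\<close> are
  hitting probabilities. Then \<open>row\<close> comes from the holding rates, \<open>col\<close>
  from stationarity, and each side is \<open>d x\<close> times a probability of returning to
  \<open>x\<close> through \<open>F\<close>.\<close>

lemma symmetrization_return_le:
  fixes a b :: "'e \<Rightarrow> 'e \<Rightarrow> real" and d h k :: "'e \<Rightarrow> real"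
  assumes F: "finite F" "x \<in> F"
    and nonneg: "\<And>y z. 0 \<le> a y z"
    and row: "\<And>y. y \<in> F \<Longrightarrow> (\<Sum>z\<in>F. a y z) \<le> d y"
    and col: "\<And>z. z \<in> F \<Longrightarrow> (\<Sum>y\<in>F. a y z) \<le> d z"
    and b: "\<And>y z. b y z = (a y z + a z y) / 2"
    and hx: "h x = 1" and kx: "k x = 1"
    and h: "\<And>y. y \<in> F \<Longrightarrow> y \<noteq> x \<Longrightarrow> d y * h y = (\<Sum>z\<in>F. a y z * h z)"
    and k: "\<And>y. y \<in> F \<Longrightarrow> y \<noteq> x \<Longrightarrow> d y * k y = (\<Sum>z\<in>F. b y z * k z)"
  shows "(\<Sum>z\<in>F. a x z * h z) \<le> (\<Sum>z\<in>F. b x z * k z)"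
proof -
  define E where "E c f g = (\<Sum>y\<in>F. d y * (f y * g y)) - (\<Sum>y\<in>F. \<Sum>z\<in>F. c y z * (f y * g z))"
    for c :: "'e \<Rightarrow> 'e \<Rightarrow> real" and f g :: "'e \<Rightarrow> real"
  \<comment> \<open>Harmonicity of \<open>g\<close> kills every term with
    \<open>y \<noteq> x\<close>, so the value depends on \<open>f\<close> only through
    \<open>f x = 1\<close>. In particular \<open>E b h k = E b k k\<close>.\<close>
  have harmonic: "E c f g = d x - (\<Sum>z\<in>F. c x z * g z)"
    if "f x = 1" "g x = 1"
      and g: "\<And>y. y \<in> F \<Longrightarrow> y \<noteq> x \<Longrightarrow> d y * g y = (\<Sum>z\<in>F. c y z * g z)" for c f g
  proof -
    have "E c f g = (\<Sum>y\<in>F. f y * (d y * g y - (\<Sum>z\<in>F. c y z * g z)))"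
      unfolding E_def by (simp add: algebra_simps sum_subtractf sum_distrib_left)
    also have "\<dots> = (\<Sum>y\<in>{x}. f y * (d y * g y - (\<Sum>z\<in>F. c y z * g z)))"
      using F g by (intro sum.mono_neutral_right) auto
    finally show ?thesis
      using that by simp
  qed
  have swap: "(\<Sum>y\<in>F. \<Sum>z\<in>F. a z y * (f y * g z)) = (\<Sum>y\<in>F. \<Sum>z\<in>F. a y z * (g y * f z))" for f g
    by (subst sum.swap) (simp add: mult.commute)
  have E_b: "E b f g = (E a f g + E a g f) / 2" for f g
  proof -
    have "(\<Sum>y\<in>F. \<Sum>z\<in>F. b y z * (f y * g z)) =
        ((\<Sum>y\<in>F. \<Sum>z\<in>F. a y z * (f y * g z)) + (\<Sum>y\<in>F. \<Sum>z\<in>F. a z y * (f y * g z))) / 2"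
      by (simp add: b sum.distrib[symmetric] sum_divide_distrib distrib_right)
    then show ?thesis
      using swap[of f g] by (simp add: E_def field_simps)
  qed
  have "0 \<le> E a (\<lambda>y. h y - k y) (\<lambda>y. h y - k y)"
    using dirichlet_form_nonneg[of a F d "\<lambda>y. h y - k y", OF nonneg row col]
    by (simp add: E_def power2_eq_square)
  also have "\<dots> = E a h h + E a k k - (E a h k + E a k h)"
    unfolding E_def by (simp add: algebra_simps sum.distrib sum_subtractf sum_distrib_left)
  \<comment> \<open>The cross terms add up to \<open>2 * E b h k\<close>, and on the diagonal the
    forms of \<open>a\<close> and \<open>b\<close> agree.\<close>
  also have "\<dots> = E a h h + E b k k - 2 * E b h k"
    by (simp add: E_b field_simps)
  \<comment> \<open>By \<open>harmonic\<close> what remains is \<open>E a h h - E b k k\<close>, in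
    which \<open>d x\<close> cancels.\<close>
  also have "\<dots> = (\<Sum>z\<in>F. b x z * k z) - (\<Sum>z\<in>F. a x z * h z)"
    using h k hx kx by (simp add: harmonic)
  finally show ?thesis
    by simp
qed

section \<open>Hitting probabilities\<close>

text \<open>The probability of reaching \<open>x\<close> from \<open>y\<close> in at most
  \<open>n\<close> steps through \<open>F\<close>, as a first-step recursion on a bare kernel;
  \<open>prob_hit_within\<close> links it to a chain. Steps that leave \<open>F\<close> are
  killed.\<close>

primrec hit_within :: "('e \<Rightarrow> 'e \<Rightarrow> real) \<Rightarrow> 'e set \<Rightarrow> 'e \<Rightarrow> nat \<Rightarrow> 'e \<Rightarrow> real" where
  "hit_within p F x 0 y = of_bool (y = x)"
| "hit_within p F x (Suc n) y =
     (if y = x then 1 else if y \<in> F then \<Sum>z\<in>F. p y z * hit_within p F x n z else 0)"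

text \<open>For a nonnegative kernel with row sums over \<open>F\<close> at most 1 the sequence is
  increasing and bounded, so \<open>lim\<close> is a genuine limit.\<close>

definition hit_prob :: "('e \<Rightarrow> 'e \<Rightarrow> real) \<Rightarrow> 'e set \<Rightarrow> 'e \<Rightarrow> 'e \<Rightarrow> real" where
  "hit_prob p F x y = lim (\<lambda>n. hit_within p F x n y)"

context
  fixes p :: "'e \<Rightarrow> 'e \<Rightarrow> real" and F :: "'e set" and x :: 'e
  assumes p_nonneg: "\<And>y z. 0 \<le> p y z"
    and p_sum: "\<And>y. (\<Sum>z\<in>F. p y z) \<le> 1"
begin

lemma hit_within_nonneg: "0 \<le> hit_within p F x n y"
  by (induction n arbitrary: y) (auto intro!: sum_nonneg mult_nonneg_nonneg p_nonneg)

lemma hit_within_le_1: "hit_within p F x n y \<le> 1"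
proof (induction n arbitrary: y)
  case (Suc n)
  have "(\<Sum>z\<in>F. p y z * hit_within p F x n z) \<le> (\<Sum>z\<in>F. p y z)"
    using Suc p_nonneg by (intro sum_mono mult_left_le) auto
  then show ?case
    using p_sum[of y] by auto
qed auto

lemma hit_within_Suc: "hit_within p F x n y \<le> hit_within p F x (Suc n) y"
proof (induction n arbitrary: y)
  case 0
  then show ?case by (auto intro!: sum_nonneg p_nonneg)
next
  case (Suc n)
  have "(\<Sum>z\<in>F. p y z * hit_within p F x n z) \<le> (\<Sum>z\<in>F. p y z * hit_within p F x (Suc n) z)"
    by (intro sum_mono mult_left_mono Suc p_nonneg)
  then show ?case by simp
qed

lemma hit_within_tendsto: "(\<lambda>n. hit_within p F x n y) \<longlonglongrightarrow> hit_prob p F x y"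
proof -
  have "incseq (\<lambda>n. hit_within p F x n y)"
    by (intro incseq_SucI hit_within_Suc)
  moreover have "Bseq (\<lambda>n. hit_within p F x n y)"
    using hit_within_nonneg hit_within_le_1 by (intro BseqI'[where K = 1]) auto
  ultimately have "convergent (\<lambda>n. hit_within p F x n y)"
    by (intro Bseq_monoseq_convergent) (auto simp: monoseq_iff)
  then show ?thesis
    by (simp add: hit_prob_def convergent_LIMSEQ_iff)
qed

lemma hit_within_le_hit_prob: "hit_within p F x n y \<le> hit_prob p F x y"
  by (rule incseq_le[OF incseq_SucI hit_within_tendsto]) (rule hit_within_Suc)

lemma hit_prob_self: "hit_prob p F x x = 1"
proof -
  have "hit_within p F x n x = 1" for n
    by (cases n) auto
  then show ?thesis
    by (simp add: hit_prob_def)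
qed

lemma hit_prob_harmonic:
  assumes "y \<in> F" "y \<noteq> x"
  shows "hit_prob p F x y = (\<Sum>z\<in>F. p y z * hit_prob p F x z)"
proof (rule LIMSEQ_unique)
  show "(\<lambda>n. hit_within p F x (Suc n) y) \<longlonglongrightarrow> hit_prob p F x y"
    using hit_within_tendsto by (rule LIMSEQ_Suc)
  show "(\<lambda>n. hit_within p F x (Suc n) y) \<longlonglongrightarrow> (\<Sum>z\<in>F. p y z * hit_prob p F x z)"
    using assms by (simp, intro tendsto_intros hit_within_tendsto)
qed

end

section \<open>The embedded jump chain\<close>

text \<open>The Markov property is encoded by cylinder probabilities, which avoids conditioning on
  null events.\<close>

locale jump_chain = prob_space M for M :: "'w measure" +
  fixes p :: "'e::countable \<Rightarrow> 'e \<Rightarrow> real" and x :: 'e and Y :: "nat \<Rightarrow> 'w \<Rightarrow> 'e"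
  assumes Y_measurable [measurable]: "\<And>n. Y n \<in> measurable M (count_space UNIV)"
    and law: "\<And>n y. prob {\<omega> \<in> space M. \<forall>i\<le>n. Y i \<omega> = y i} =
                of_bool (y 0 = x) * (\<Prod>i<n. p (y i) (y (Suc i)))"
begin

text \<open>\<open>y\<close> prescribes the history up to time \<open>m\<close>,
  \<open>y(Suc m := z)\<close> extends it by one state, and \<open>Q\<close> is meant for an event
  of the future.\<close>

lemma prob_split_next:
  assumes F: "finite F" and [measurable]: "Measurable.pred M Q"
  shows "prob {\<omega> \<in> space M. (\<forall>i\<le>m. Y i \<omega> = y i) \<and> Y (Suc m) \<omega> \<in> F \<and> Q \<omega>} =
    (\<Sum>z\<in>F. prob {\<omega> \<in> space M. (\<forall>i\<le>Suc m. Y i \<omega> = (y(Suc m := z)) i) \<and> Q \<omega>})"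
proof -
  have "{\<omega> \<in> space M. (\<forall>i\<le>m. Y i \<omega> = y i) \<and> Y (Suc m) \<omega> \<in> F \<and> Q \<omega>} =
    (\<Union>z\<in>F. {\<omega> \<in> space M. (\<forall>i\<le>Suc m. Y i \<omega> = (y(Suc m := z)) i) \<and> Q \<omega>})"
    by (auto simp: le_Suc_eq)
  moreover have "disjoint_family_on (\<lambda>z. {\<omega> \<in> space M. (\<forall>i\<le>Suc m. Y i \<omega> = (y(Suc m := z)) i) \<and> Q \<omega>}) F"
    by (auto simp: disjoint_family_on_def le_Suc_eq)
  moreover have "(\<lambda>z. {\<omega> \<in> space M. (\<forall>i\<le>Suc m. Y i \<omega> = (y(Suc m := z)) i) \<and> Q \<omega>}) ` F \<subseteq> events"
    by (intro image_subsetI) measurable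
  ultimately show ?thesis
    using F by (simp only: finite_measure_finite_Union)
qed

lemma law_Suc:
  "prob {\<omega> \<in> space M. \<forall>i\<le>Suc m. Y i \<omega> = (y(Suc m := z)) i} =
    prob {\<omega> \<in> space M. \<forall>i\<le>m. Y i \<omega> = y i} * p (y m) z"
  unfolding law by (auto simp: lessThan_Suc)

text \<open>The Markov property at time \<open>m\<close>, in product form so that null histories
  cause no trouble. The induction on \<open>n\<close> must cover all \<open>m\<close> and
  \<open>y\<close>, because the first step lengthens the history.\<close>

lemma prob_hit_within:
  assumes F: "finite F" "x \<in> F"
  shows "prob {\<omega> \<in> space M. (\<forall>i\<le>m. Y i \<omega> = y i) \<and> (\<exists>k\<le>n. Y (m + k) \<omega> = x \<and> (\<forall>j<k. Y (m + j) \<omega> \<in> F))} =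
    prob {\<omega> \<in> space M. \<forall>i\<le>m. Y i \<omega> = y i} * hit_within p F x n (y m)"
proof (induction n arbitrary: m y)
  case 0
  have "{\<omega> \<in> space M. (\<forall>i\<le>m. Y i \<omega> = y i) \<and> Y m \<omega> = x} =
      (if y m = x then {\<omega> \<in> space M. \<forall>i\<le>m. Y i \<omega> = y i} else {})"
    by auto
  then show ?case by simp
next
  case (Suc n)
  define Q where "Q m n \<omega> \<longleftrightarrow> (\<exists>k\<le>n. Y (m + k) \<omega> = x \<and> (\<forall>j<k. Y (m + j) \<omega> \<in> F))" for m n \<omega>
  have Q_measurable: "Measurable.pred M (Q m n)" for m n
    unfolding Q_def by measurable
  \<comment> \<open>The conjunct \<open>Y (Suc m) \<omega> \<in> F\<close> follows from the hit,
    since the next state is either \<open>x \<in> F\<close> or a state before the hit. It is spelled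
    out because \<open>prob_split_next\<close> sums over the finite set \<open>F\<close>.\<close>
  have Q_Suc: "Q m (Suc n) \<omega> \<longleftrightarrow> Y m \<omega> = x \<or> Y m \<omega> \<in> F \<and> Y (Suc m) \<omega> \<in> F \<and> Q (Suc m) n \<omega>" for \<omega>
  proof -
    have *: "(\<exists>k\<le>Suc n. R k) \<longleftrightarrow> R 0 \<or> (\<exists>k\<le>n. R (Suc k))" for R
      by (metis Suc_le_mono le0 not0_implies_Suc)
    have "Q m (Suc n) \<omega> \<longleftrightarrow> Y m \<omega> = x \<or> Y m \<omega> \<in> F \<and> Q (Suc m) n \<omega>"
      unfolding Q_def * All_less_Suc2 by auto
    moreover have "Y (Suc m) \<omega> \<in> F" if hit: "Q (Suc m) n \<omega>"
    proof -
      obtain k where "Y (Suc m + k) \<omega> = x" "\<forall>j<k. Y (Suc m + j) \<omega> \<in> F"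
        using hit unfolding Q_def by blast
      then show ?thesis
        using F by (cases k) auto
    qed
    ultimately show ?thesis by blast
  qed
  consider "y m = x" | "y m \<noteq> x" "y m \<notin> F" | "y m \<noteq> x" "y m \<in> F"
    by blast
  then have "prob {\<omega> \<in> space M. (\<forall>i\<le>m. Y i \<omega> = y i) \<and> Q m (Suc n) \<omega>} =
    prob {\<omega> \<in> space M. \<forall>i\<le>m. Y i \<omega> = y i} * hit_within p F x (Suc n) (y m)"
  proof cases
    case 1
    then have "{\<omega> \<in> space M. (\<forall>i\<le>m. Y i \<omega> = y i) \<and> Q m (Suc n) \<omega>} =
        {\<omega> \<in> space M. \<forall>i\<le>m. Y i \<omega> = y i}"
      by (auto simp: Q_Suc)
    with 1 show ?thesis by simp
  next
    case 2
    then have empty: "{\<omega> \<in> space M. (\<forall>i\<le>m. Y i \<omega> = y i) \<and> Q m (Suc n) \<omega>} = {}"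
      by (auto simp: Q_Suc)
    from 2 show ?thesis
      unfolding empty by simp
  next
    case 3
    then have "{\<omega> \<in> space M. (\<forall>i\<le>m. Y i \<omega> = y i) \<and> Q m (Suc n) \<omega>} =
        {\<omega> \<in> space M. (\<forall>i\<le>m. Y i \<omega> = y i) \<and> Y (Suc m) \<omega> \<in> F \<and> Q (Suc m) n \<omega>}"
      by (auto simp: Q_Suc)
    then have "prob {\<omega> \<in> space M. (\<forall>i\<le>m. Y i \<omega> = y i) \<and> Q m (Suc n) \<omega>} =
        (\<Sum>z\<in>F. prob {\<omega> \<in> space M. (\<forall>i\<le>Suc m. Y i \<omega> = (y(Suc m := z)) i) \<and> Q (Suc m) n \<omega>})"
      by (simp only: prob_split_next[OF F(1) Q_measurable])
    also have "\<dots> = (\<Sum>z\<in>F. prob {\<omega> \<in> space M. \<forall>i\<le>m. Y i \<omega> = y i} *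
        (p (y m) z * hit_within p F x n z))"
      unfolding Q_def Suc.IH law_Suc by (simp add: mult.assoc)
    finally show ?thesis
      using 3 by (simp add: sum_distrib_left)
  qed
  then show ?case
    unfolding Q_def .
qed

text \<open>A first step from \<open>x\<close> to \<open>z\<close>, then
  \<open>prob_hit_within\<close> with history \<open>x, z\<close>. The shift by one step keeps the
  start at \<open>x\<close> from counting as a hit.\<close>

lemma prob_return_within:
  assumes F: "finite F" "x \<in> F"
  shows "prob {\<omega> \<in> space M. Y 0 \<omega> = x \<and> Y (Suc 0) \<omega> \<in> F \<and>
      (\<exists>k\<le>n. Y (Suc k) \<omega> = x \<and> (\<forall>j<k. Y (Suc j) \<omega> \<in> F))} =
    (\<Sum>z\<in>F. p x z * hit_within p F x n z)"
proof -
  have "prob {\<omega> \<in> space M. (\<forall>i\<le>0. Y i \<omega> = x) \<and> Y (Suc 0) \<omega> \<in> F \<and>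
      (\<exists>k\<le>n. Y (Suc 0 + k) \<omega> = x \<and> (\<forall>j<k. Y (Suc 0 + j) \<omega> \<in> F))} =
    (\<Sum>z\<in>F. prob {\<omega> \<in> space M. (\<forall>i\<le>Suc 0. Y i \<omega> = ((\<lambda>_. x)(Suc 0 := z)) i) \<and>
      (\<exists>k\<le>n. Y (Suc 0 + k) \<omega> = x \<and> (\<forall>j<k. Y (Suc 0 + j) \<omega> \<in> F))})"
    by (rule prob_split_next[OF F(1)]) measurable
  also have "\<dots> = (\<Sum>z\<in>F. p x z * hit_within p F x n z)"
    unfolding prob_hit_within[OF F] law_Suc law by simp
  finally show ?thesis
    by simp
qed

text \<open>A returning path visits finitely many states before its return, so the return event is
  the increasing union of returns within finite sets and bounded time.\<close>

lemma prob_return_le: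
  assumes le: "\<And>F n. finite F \<Longrightarrow> x \<in> F \<Longrightarrow> (\<Sum>z\<in>F. p x z * hit_within p F x n z) \<le> c"
  shows "prob {\<omega> \<in> space M. Y 0 \<omega> = x \<and> (\<exists>k. Y (Suc k) \<omega> = x)} \<le> c"
proof -
  \<comment> \<open>Finite exhaustion of the state space through the injection
    \<open>to_nat\<close>.\<close>
  define F where "F n = insert x {z :: 'e. to_nat z \<le> n}" for n
  have F: "finite (F n)" "x \<in> F n" for n
  proof -
    have "{z :: 'e. to_nat z \<le> n} = to_nat -` {..n}"
      by auto
    then show "finite (F n)"
      by (simp add: F_def finite_vimageI)
  qed (simp add: F_def)
  have F_mono: "F m \<subseteq> F n" if "m \<le> n" for m n
    using that by (auto simp: F_def)
  define A where "A n = {\<omega> \<in> space M. Y 0 \<omega> = x \<and> Y (Suc 0) \<omega> \<in> F n \<and>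
      (\<exists>k\<le>n. Y (Suc k) \<omega> = x \<and> (\<forall>j<k. Y (Suc j) \<omega> \<in> F n))}" for n
  have "incseq A"
  proof (rule incseq_SucI)
    show "A n \<subseteq> A (Suc n)" for n
      using F_mono[of n "Suc n"] unfolding A_def by (auto intro: le_SucI)
  qed
  moreover have "A n \<in> events" for n
    unfolding A_def by measurable
  ultimately have "(\<lambda>n. prob (A n)) \<longlonglongrightarrow> prob (\<Union>n. A n)"
    by (intro finite_Lim_measure_incseq) auto
  moreover have "prob (A n) \<le> c" for n
    unfolding A_def prob_return_within[OF F] by (rule le[OF F])
  ultimately have "prob (\<Union>n. A n) \<le> c"
    by (intro LIMSEQ_le_const2) auto
  moreover have "(\<Union>n. A n) = {\<omega> \<in> space M. Y 0 \<omega> = x \<and> (\<exists>k. Y (Suc k) \<omega> = x)}"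
  proof (intro equalityI subsetI)
    fix \<omega> assume "\<omega> \<in> {\<omega> \<in> space M. Y 0 \<omega> = x \<and> (\<exists>k. Y (Suc k) \<omega> = x)}"
    then obtain k where k: "\<omega> \<in> space M" "Y 0 \<omega> = x" "Y (Suc k) \<omega> = x"
      by auto
    \<comment> \<open>One index has to bound both the return time and the codes of all states
      visited.\<close>
    define n where "n = k + (\<Sum>j\<le>k. to_nat (Y (Suc j) \<omega>))"
    have "Y (Suc j) \<omega> \<in> F n" if "j \<le> k" for j
    proof -
      have "to_nat (Y (Suc j) \<omega>) \<le> (\<Sum>j\<le>k. to_nat (Y (Suc j) \<omega>))"
        using that by (intro member_le_sum) auto
      then show ?thesis
        by (simp add: F_def n_def)
    qed
    then have "\<omega> \<in> A n"
      using k unfolding A_def by (auto intro!: exI[of _ k] simp: n_def)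
    then show "\<omega> \<in> (\<Union>n. A n)"
      by auto
  qed (auto simp: A_def)
  ultimately show ?thesis
    by simp
qed

lemma return_within_le_prob_return:
  assumes "finite F" "x \<in> F"
  shows "(\<Sum>z\<in>F. p x z * hit_within p F x n z) \<le>
    prob {\<omega> \<in> space M. Y 0 \<omega> = x \<and> (\<exists>k. Y (Suc k) \<omega> = x)}"
proof -
  have "{\<omega> \<in> space M. Y 0 \<omega> = x \<and> (\<exists>k. Y (Suc k) \<omega> = x)} \<in> events"
    by measurable
  then show ?thesis
    unfolding prob_return_within[OF assms, symmetric]
    by (rule finite_measure_mono[rotated]) blast
qed

lemma prob_start: "prob {\<omega> \<in> space M. Y 0 \<omega> = x} = 1"
  using law[of 0 "\<lambda>_. x"] by simp

lemma AE_start: "AE \<omega> in M. Y 0 \<omega> = x"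
  using prob_start by (simp add: prob_Collect_eq_1)

lemma AE_first_jump:
  assumes "p x x = 0"
  shows "AE \<omega> in M. Y (Suc 0) \<omega> \<noteq> x"
proof -
  have "prob {\<omega> \<in> space M. \<forall>i\<le>Suc 0. Y i \<omega> = x} = 0"
    using law[of "Suc 0" "\<lambda>_. x"] assms by simp
  then have "AE \<omega> in M. \<not> (\<forall>i\<le>Suc 0. Y i \<omega> = x)"
    by (subst (asm) prob_Collect_eq_0) measurable
  with AE_start show ?thesis
    by eventually_elim (auto simp: le_Suc_eq)
qed

lemma prob_escape:
  "prob {\<omega> \<in> space M. \<forall>k. Y (Suc k) \<omega> \<noteq> x} =
    1 - prob {\<omega> \<in> space M. Y 0 \<omega> = x \<and> (\<exists>k. Y (Suc k) \<omega> = x)}"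
proof -
  have "prob {\<omega> \<in> space M. Y 0 \<omega> = x \<and> (\<exists>k. Y (Suc k) \<omega> = x)} =
      prob {\<omega> \<in> space M. \<exists>k. Y (Suc k) \<omega> = x}"
    using AE_start by (intro measure_eq_AE) auto
  also have "\<dots> = 1 - prob {\<omega> \<in> space M. \<not> (\<exists>k. Y (Suc k) \<omega> = x)}"
    by (subst prob_neg) measurable
  finally show ?thesis
    by simp
qed

end

section \<open>Paths of the jump process\<close>

text \<open>The pathwise clauses of \<open>markov_from\<close> for a single path, so that path
  arguments are free of probability.\<close>

definition jump_path ::
    "(nat \<Rightarrow> 'e) \<Rightarrow> (nat \<Rightarrow> ennreal) \<Rightarrow> (real \<Rightarrow> 'e option) \<Rightarrow> bool" where
  "jump_path y s q \<longleftrightarrow>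
     (\<forall>n. 0 < s n) \<and>
     (\<forall>t\<ge>0.
        (\<forall>n. (\<Sum>i<n. s i) \<le> ennreal t \<and> ennreal t < (\<Sum>i<Suc n. s i) \<longrightarrow> q t = Some (y n)) \<and>
        ((\<forall>n. (\<Sum>i<n. s i) \<le> ennreal t) \<longrightarrow> q t = None))"

context
  fixes y :: "nat \<Rightarrow> 'e" and s :: "nat \<Rightarrow> ennreal" and q :: "real \<Rightarrow> 'e option"
  assumes path: "jump_path y s q"
begin

lemma le_ennreal_imp_finite: "a \<le> ennreal t \<Longrightarrow> a < \<infinity>"
  using le_less_trans[OF _ ennreal_less_top] by simp

lemma jump_time_mono: "m \<le> n \<Longrightarrow> (\<Sum>i<m. s i) \<le> (\<Sum>i<n. s i)"
  by (intro sum_mono2) auto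

lemma jump_time_strict:
  assumes "(\<Sum>i<n. s i) < \<infinity>"
  shows "(\<Sum>i<n. s i) < (\<Sum>i<Suc n. s i)"
proof -
  have "0 < s n"
    using path by (simp add: jump_path_def)
  \<comment> \<open>Strict monotonicity of addition in \<open>ennreal\<close> fails at \<infinity>;
    here the finite jump time is used.\<close>
  then have "(\<Sum>i<n. s i) + 0 < (\<Sum>i<n. s i) + s n"
    using assms unfolding ennreal_add_left_cancel_less by (metis infinity_ennreal_def less_irrefl)
  then show ?thesis
    by simp
qed

lemma path_None:
  assumes "0 \<le> t" "\<And>n. (\<Sum>i<n. s i) \<le> ennreal t"
  shows "q t = None"
  by (rule path[unfolded jump_path_def, THEN conjunct2, THEN spec, THEN mp, OF assms(1),
        THEN conjunct2, THEN mp, OF allI[OF assms(2)]])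

lemma path_Some:
  assumes "0 \<le> t" "(\<Sum>i<n. s i) \<le> ennreal t" "ennreal t < (\<Sum>i<Suc n. s i)"
  shows "q t = Some (y n)"
  by (rule path[unfolded jump_path_def, THEN conjunct2, THEN spec, THEN mp, OF assms(1),
        THEN conjunct1, THEN spec, THEN mp, OF conjI[OF assms(2,3)]])

lemma path_cases:
  assumes "0 \<le> t"
  obtains (explosion) "\<And>n. (\<Sum>i<n. s i) \<le> ennreal t" "q t = None"
  | (interval) n where "(\<Sum>i<n. s i) \<le> ennreal t" "ennreal t < (\<Sum>i<Suc n. s i)" "q t = Some (y n)"
proof (cases "\<forall>n. (\<Sum>i<n. s i) \<le> ennreal t")
  case True
  then show ?thesis
    by (intro explosion path_None assms) auto
next
  case False
  \<comment> \<open>The first jump time beyond \<open>t\<close>. It is not the one with index 0,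
    since the empty sum is 0, so its predecessor gives the interval containing
    \<open>t\<close>.\<close>
  define n where "n = (LEAST n. \<not> (\<Sum>i<n. s i) \<le> ennreal t)"
  have n: "\<not> (\<Sum>i<n. s i) \<le> ennreal t"
    unfolding n_def by (rule LeastI_ex) (use False in blast)
  then obtain m where m: "n = Suc m"
    by (cases n) auto
  then have "(\<Sum>i<m. s i) \<le> ennreal t"
    using not_less_Least[of m "\<lambda>n. \<not> (\<Sum>i<n. s i) \<le> ennreal t"] by (simp add: n_def)
  moreover have "ennreal t < (\<Sum>i<Suc m. s i)"
    using n m by (simp only: not_le)
  ultimately show ?thesis
    by (intro interval path_Some assms)
qed

lemma path_at_jump_time:
  assumes "(\<Sum>i<n. s i) < \<infinity>"
  obtains t where "0 \<le> t" "ennreal t = (\<Sum>i<n. s i)" "q t = Some (y n)"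
proof -
  define t where "t = enn2real (\<Sum>i<n. s i)"
  have t: "0 \<le> t" "ennreal t = (\<Sum>i<n. s i)"
    using assms by (auto simp: t_def)
  moreover have "q t = Some (y n)"
    using t jump_time_strict[OF assms] by (intro path_Some) auto
  ultimately show ?thesis
    using that by blast
qed

text \<open>Turns a condition on uncountably many times into countably many conditions on states and
  jump times. Explosion counts as leaving, because the path is then \<open>None\<close>.\<close>

lemma path_leaves_iff:
  "(\<exists>t\<ge>0. q t \<noteq> Some x) \<longleftrightarrow>
    (\<exists>n. (\<Sum>i<n. s i) < \<infinity> \<and> y n \<noteq> x) \<or> (SUP n. \<Sum>i<n. s i) < \<infinity>"
proof
  assume "\<exists>t\<ge>0. q t \<noteq> Some x"
  then obtain t where t: "0 \<le> t" "q t \<noteq> Some x"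
    by blast
  from t(1) show "(\<exists>n. (\<Sum>i<n. s i) < \<infinity> \<and> y n \<noteq> x) \<or> (SUP n. \<Sum>i<n. s i) < \<infinity>"
  proof (cases rule: path_cases)
    case explosion
    then have "(SUP n. \<Sum>i<n. s i) \<le> ennreal t"
      by (intro SUP_least)
    then have "(SUP n. \<Sum>i<n. s i) < \<infinity>"
      by (rule le_ennreal_imp_finite)
    then show ?thesis ..
  next
    case (interval n)
    then have "(\<Sum>i<n. s i) < \<infinity>"
      by (intro le_ennreal_imp_finite)
    with interval t show ?thesis by auto
  qed
next
  assume "(\<exists>n. (\<Sum>i<n. s i) < \<infinity> \<and> y n \<noteq> x) \<or> (SUP n. \<Sum>i<n. s i) < \<infinity>"
  then show "\<exists>t\<ge>0. q t \<noteq> Some x"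
  proof
    assume "\<exists>n. (\<Sum>i<n. s i) < \<infinity> \<and> y n \<noteq> x"
    then obtain n where "(\<Sum>i<n. s i) < \<infinity>" "y n \<noteq> x"
      by blast
    then show ?thesis
      using path_at_jump_time[of n] by (metis option.inject)
  next
    \<comment> \<open>The explosion time itself is a time at which the path has left
      \<open>x\<close>.\<close>
    assume fin: "(SUP n. \<Sum>i<n. s i) < \<infinity>"
    define t where "t = enn2real (SUP n. \<Sum>i<n. s i)"
    have "ennreal t = (SUP n. \<Sum>i<n. s i)" "0 \<le> t"
      using fin by (auto simp: t_def)
    then have "q t = None"
      by (intro path_None) (auto intro: SUP_upper)
    with \<open>0 \<le> t\<close> show ?thesis by auto
  qed
qed

text \<open>The infimum is \<infinity> exactly when its set of times is empty, since those times are
  real. Times \<open>u < t\<close> then correspond to indices \<open>m < n\<close> of holding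
  intervals.\<close>

lemma return_time_infinite_iff:
  "return_time q x = \<infinity> \<longleftrightarrow> \<not> (\<exists>m n. m < n \<and> (\<Sum>i<n. s i) < \<infinity> \<and> y n = x \<and> y m \<noteq> x)"
proof -
  have "return_time q x = \<infinity> \<longleftrightarrow>
      \<not> (\<exists>t. 0 < t \<and> q t = Some x \<and> (\<exists>u. 0 < u \<and> u < t \<and> q u \<noteq> Some x))"
    unfolding return_time_def by (auto simp: Inf_top_conv infinity_ennreal_def)
  also have "(\<exists>t. 0 < t \<and> q t = Some x \<and> (\<exists>u. 0 < u \<and> u < t \<and> q u \<noteq> Some x)) \<longleftrightarrow>
      (\<exists>m n. m < n \<and> (\<Sum>i<n. s i) < \<infinity> \<and> y n = x \<and> y m \<noteq> x)"
  proof (intro iffI; elim exE conjE)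
    fix t u
    assume tu: "0 < t" "q t = Some x" "0 < u" "u < t" "q u \<noteq> Some x"
    then have "0 \<le> t" "0 \<le> u"
      by auto
    from \<open>0 \<le> t\<close> show "\<exists>m n. m < n \<and> (\<Sum>i<n. s i) < \<infinity> \<and> y n = x \<and> y m \<noteq> x"
    proof (cases rule: path_cases)
      case (interval n)
      have less: "ennreal u < ennreal t"
        using tu by (simp add: ennreal_less_iff)
      from \<open>0 \<le> u\<close> show ?thesis
      proof (cases rule: path_cases)
        \<comment> \<open>Explosion by time \<open>u\<close> would put all jump times at or before
          \<open>u\<close>, but one of them lies after \<open>t > u\<close>.\<close>
        case explosion
        then show ?thesis
          using less interval(2) by (meson less_trans not_le)
      next
        case u: (interval m)
        have "(\<Sum>i<m. s i) < (\<Sum>i<Suc n. s i)"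
          using u(1) less interval(2) by (meson le_less_trans less_trans)
        then have "m < Suc n"
          using jump_time_mono[of "Suc n" m] by (meson not_le)
        moreover have "m \<noteq> n"
          using u interval tu by auto
        moreover have "(\<Sum>i<n. s i) < \<infinity>"
          using interval(1) by (rule le_ennreal_imp_finite)
        ultimately show ?thesis
          using u(3) interval(3) tu(2,5) by (metis le_neq_implies_less less_Suc_eq_le option.inject)
      qed
    qed (use tu in auto)
  next
    fix m n
    assume mn: "m < n" "(\<Sum>i<n. s i) < \<infinity>" "y n = x" "y m \<noteq> x"
    obtain t where t: "0 \<le> t" "ennreal t = (\<Sum>i<n. s i)" "q t = Some (y n)"
      using path_at_jump_time mn(2) by blast
    have le: "(\<Sum>i<Suc m. s i) \<le> (\<Sum>i<n. s i)"
      using mn(1) by (intro jump_time_mono) auto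
    have fin: "(\<Sum>i<m. s i) < \<infinity>"
      using jump_time_mono[of m n] mn(1,2) by auto
    \<comment> \<open>The time must lie strictly inside the holding interval: for
      \<open>m = 0\<close> its left end is 0, whereas \<open>return_time\<close> asks for
      \<open>0 < u\<close>.\<close>
    obtain v where v: "(\<Sum>i<m. s i) < v" "v < (\<Sum>i<Suc m. s i)"
      using dense[OF jump_time_strict[OF fin]] by blast
    define u where "u = enn2real v"
    have "v < \<infinity>"
      using v(2) le mn(2) by (meson less_le_trans less_trans)
    then have u: "ennreal u = v" "0 \<le> u"
      by (auto simp: u_def)
    have "0 < ennreal u"
      using v(1) u(1) by (metis not_less_zero zero_less_iff_neq_zero)
    then have "0 < u"
      by simp
    have "ennreal u < ennreal t"
      using u t v le by auto
    then have "u < t"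
      using u(2) by (simp only: ennreal_less_iff)
    moreover have "q u = Some (y m)"
      using u v by (intro path_Some) auto
    ultimately show "\<exists>t. 0 < t \<and> q t = Some x \<and> (\<exists>u. 0 < u \<and> u < t \<and> q u \<noteq> Some x)"
      using \<open>0 < u\<close> t mn by (intro exI[of _ t] conjI exI[of _ u]) auto
  qed
  finally show ?thesis .
qed

end


section \<open>From the process to its jump chain\<close>

definition jump_holding_law ::
    "('e::countable \<Rightarrow> 'e \<Rightarrow> real) \<Rightarrow> 'e \<Rightarrow> 'w measure \<Rightarrow> (nat \<Rightarrow> 'w \<Rightarrow> 'e) \<Rightarrow> (nat \<Rightarrow> 'w \<Rightarrow> ennreal) \<Rightarrow> bool"
  where "jump_holding_law r x M Y S \<longleftrightarrow>
    (\<forall>n y s. (\<forall>i. 0 \<le> s i) \<longrightarrow>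
       measure M {\<omega> \<in> space M. \<forall>i\<le>n. Y i \<omega> = y i \<and> ennreal (s i) < S i \<omega>} =
         of_bool (y 0 = x) * (\<Prod>i<n. jump_prob r (y i) (y (Suc i)))
           * (\<Prod>i\<le>n. exp (- holding_rate r (y i) * s i)))"

lemma jump_holding_lawD:
  assumes "jump_holding_law r x M Y S" "\<And>i. 0 \<le> s i"
  shows "measure M {\<omega> \<in> space M. \<forall>i\<le>n. Y i \<omega> = y i \<and> ennreal (s i) < S i \<omega>} =
    of_bool (y 0 = x) * (\<Prod>i<n. jump_prob r (y i) (y (Suc i)))
      * (\<Prod>i\<le>n. exp (- holding_rate r (y i) * s i))"
  by (rule assms(1)[unfolded jump_holding_law_def, THEN spec, THEN spec, THEN spec, THEN mp,
        OF allI[OF assms(2)]])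

text \<open>Taking all thresholds \<open>s i = 0\<close> turns the exponential factors into 1, and
  positive holding times make the constraints on \<open>S\<close> vacuous; the law of
  \<open>Y\<close> alone remains.\<close>

lemma markov_fromE:
  fixes r :: "'e::countable \<Rightarrow> 'e \<Rightarrow> real"
  assumes "markov_from r x M X"
  obtains Y S where "jump_chain M (jump_prob r) x Y"
    and "\<And>n. S n \<in> borel_measurable M"
    and "\<And>\<omega>. \<omega> \<in> space M \<Longrightarrow> jump_path (\<lambda>n. Y n \<omega>) (\<lambda>n. S n \<omega>) (\<lambda>t. X t \<omega>)"
    and "jump_holding_law r x M Y S"
proof -
  from assms obtain Y S where prob: "prob_space M"
    and Y: "\<forall>n. Y n \<in> measurable M (count_space UNIV)"
    and S: "\<forall>n. S n \<in> borel_measurable M"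
    and pos: "\<forall>n. \<forall>\<omega>\<in>space M. 0 < S n \<omega>"
    and joint_law: "jump_holding_law r x M Y S"
    and path: "\<forall>\<omega>\<in>space M. \<forall>t\<ge>0.
           (\<forall>n. (\<Sum>i<n. S i \<omega>) \<le> ennreal t \<and> ennreal t < (\<Sum>i<Suc n. S i \<omega>)
              \<longrightarrow> X t \<omega> = Some (Y n \<omega>)) \<and>
           ((\<forall>n. (\<Sum>i<n. S i \<omega>) \<le> ennreal t) \<longrightarrow> X t \<omega> = None)"
    unfolding markov_from_def jump_holding_law_def[symmetric] by (elim conjE exE) (rule that)
  have "jump_chain M (jump_prob r) x Y"
  proof (intro jump_chain.intro prob jump_chain_axioms.intro)
    fix n y
    have "{\<omega> \<in> space M. \<forall>i\<le>n. Y i \<omega> = y i} =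
        {\<omega> \<in> space M. \<forall>i\<le>n. Y i \<omega> = y i \<and> ennreal 0 < S i \<omega>}"
      using pos by auto
    then show "measure M {\<omega> \<in> space M. \<forall>i\<le>n. Y i \<omega> = y i} =
        of_bool (y 0 = x) * (\<Prod>i<n. jump_prob r (y i) (y (Suc i)))"
      using jump_holding_lawD[OF joint_law, of "\<lambda>_. 0" n y] by simp
  qed (use Y in blast)
  moreover have "jump_path (\<lambda>n. Y n \<omega>) (\<lambda>n. S n \<omega>) (\<lambda>t. X t \<omega>)" if "\<omega> \<in> space M" for \<omega>
    unfolding jump_path_def
  proof
    show "\<forall>n. 0 < S n \<omega>"
      using pos that by blast
  qed (rule bspec[OF path that])
  ultimately show thesis
    using that[of Y S] S joint_law by blast
qed

text \<open>The pathwise characterizations express the event by countably many measurable conditions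
  on \<open>Y\<close> and \<open>S\<close>.\<close>

lemma escape_event_measurable:
  fixes Y :: "nat \<Rightarrow> 'w \<Rightarrow> 'e::countable" and S :: "nat \<Rightarrow> 'w \<Rightarrow> ennreal"
  assumes [measurable]: "\<And>n. Y n \<in> measurable M (count_space UNIV)" "\<And>n. S n \<in> borel_measurable M"
    and path: "\<And>\<omega>. \<omega> \<in> space M \<Longrightarrow> jump_path (\<lambda>n. Y n \<omega>) (\<lambda>n. S n \<omega>) (\<lambda>t. X t \<omega>)"
  shows "{\<omega> \<in> space M. (\<exists>t\<ge>0. X t \<omega> \<noteq> Some x) \<and> return_time (\<lambda>t. X t \<omega>) x = \<infinity>} \<in> sets M"
proof -
  have "{\<omega> \<in> space M. (\<exists>t\<ge>0. X t \<omega> \<noteq> Some x) \<and> return_time (\<lambda>t. X t \<omega>) x = \<infinity>} =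
    {\<omega> \<in> space M.
      ((\<exists>n. (\<Sum>i<n. S i \<omega>) < \<infinity> \<and> Y n \<omega> \<noteq> x) \<or> (SUP n. \<Sum>i<n. S i \<omega>) < \<infinity>) \<and>
      \<not> (\<exists>m n. m < n \<and> (\<Sum>i<n. S i \<omega>) < \<infinity> \<and> Y n \<omega> = x \<and> Y m \<omega> \<noteq> x)}"
    by (intro Collect_cong conj_cong refl path_leaves_iff[OF path] return_time_infinite_iff[OF path])
  also have "\<dots> \<in> sets M"
    by measurable
  finally show ?thesis .
qed

text \<open>For a fixed history, an infinite \<open>n\<close>-th holding time has probability at
  most \<open>c * q ^ k\<close> for every \<open>k\<close>, with \<open>q < 1\<close>, hence 0.
  There are only countably many finite histories.\<close>

lemma AE_holding_time_finite:
  fixes r :: "'e::countable \<Rightarrow> 'e \<Rightarrow> real"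
  assumes chain: "jump_chain M (jump_prob r) x Y"
    and [measurable]: "\<And>n. S n \<in> borel_measurable M"
    and joint_law: "jump_holding_law r x M Y S"
    and rate: "\<And>z. 0 < holding_rate r z"
    and pos: "\<And>n \<omega>. \<omega> \<in> space M \<Longrightarrow> 0 < S n \<omega>"
  shows "AE \<omega> in M. \<forall>n. S n \<omega> < \<infinity>"
proof -
  interpret jump_chain M "jump_prob r" x Y by (rule chain)
  \<comment> \<open>Histories are coded as lists, a countable type, unlike functions on all of
    \<open>nat\<close>.\<close>
  have "AE \<omega> in M. \<not> ((\<forall>i\<le>n. Y i \<omega> = l ! i) \<and> S n \<omega> = \<infinity>)" for n and l :: "'e list"
  proof -
    define B where "B = {\<omega> \<in> space M. (\<forall>i\<le>n. Y i \<omega> = l ! i) \<and> S n \<omega> = \<infinity>}"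
    define c where "c = of_bool (l ! 0 = x) * (\<Prod>i<n. jump_prob r (l ! i) (l ! Suc i))"
    define q where "q = exp (- holding_rate r (l ! n))"
    have "prob B \<le> c * q ^ k" for k
    proof -
      \<comment> \<open>The threshold is \<open>k\<close> at index \<open>n\<close> only, so all
        other exponential factors equal 1.\<close>
      define s where "s = (\<lambda>_. 0 :: real)(n := real k)"
      have "B \<subseteq> {\<omega> \<in> space M. \<forall>i\<le>n. Y i \<omega> = l ! i \<and> ennreal (s i) < S i \<omega>}"
        using pos by (auto simp: B_def s_def)
      moreover have "{\<omega> \<in> space M. \<forall>i\<le>n. Y i \<omega> = l ! i \<and> ennreal (s i) < S i \<omega>} \<in> events"
        by measurable
      ultimately have "prob B \<le> prob {\<omega> \<in> space M. \<forall>i\<le>n. Y i \<omega> = l ! i \<and> ennreal (s i) < S i \<omega>}"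
        by (rule finite_measure_mono)
      also have "\<dots> = c * (\<Prod>i\<le>n. exp (- holding_rate r (l ! i) * s i))"
        unfolding c_def by (rule jump_holding_lawD[OF joint_law, where y = "(!) l"]) (simp add: s_def)
      also have "(\<Prod>i\<le>n. exp (- holding_rate r (l ! i) * s i)) =
          (\<Prod>i\<in>{n}. exp (- holding_rate r (l ! i) * s i))"
        by (intro prod.mono_neutral_right) (auto simp: s_def)
      also have "\<dots> = q ^ k"
        by (simp add: s_def q_def mult.commute flip: exp_of_nat_mult)
      finally show ?thesis .
    qed
    moreover have "(\<lambda>k. c * q ^ k) \<longlonglongrightarrow> c * 0"
      using rate[of "l ! n"] by (intro tendsto_mult tendsto_const LIMSEQ_realpow_zero) (auto simp: q_def)
    ultimately have "prob B \<le> c * 0"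
      by (intro LIMSEQ_le_const) auto
    then have "prob B = 0"
      by (simp add: measure_le_0_iff)
    then show ?thesis
      unfolding B_def by (subst (asm) prob_Collect_eq_0) measurable
  qed
  then have "AE \<omega> in M. \<forall>n. \<forall>l::'e list. \<not> ((\<forall>i\<le>n. Y i \<omega> = l ! i) \<and> S n \<omega> = \<infinity>)"
    by (simp only: AE_all_countable simp_thms)
  then show ?thesis
  proof eventually_elim
    case (elim \<omega>)
    show ?case
    proof
      fix n
      have "\<forall>i\<le>n. Y i \<omega> = map (\<lambda>i. Y i \<omega>) [0..<Suc n] ! i"
        by (auto simp del: upt_Suc)
      with elim have "S n \<omega> \<noteq> \<infinity>"
        by blast
      then show "S n \<omega> < \<infinity>"
        by (simp add: less_top)
    qed
  qed
qed

text \<open>Almost surely the first jump leaves \<open>x\<close> and all jump times are finite, so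
  every visited state is seen in real time and the path returns exactly when the chain does.\<close>

lemma prob_escape_eq:
  fixes r :: "'e::countable \<Rightarrow> 'e \<Rightarrow> real"
  assumes M: "markov_from r x M X" and rate: "\<And>z. 0 < holding_rate r z" and diag: "r x x = 0"
  obtains Y where "jump_chain M (jump_prob r) x Y"
    and "measure M {\<omega> \<in> space M. (\<exists>t\<ge>0. X t \<omega> \<noteq> Some x) \<and> return_time (\<lambda>t. X t \<omega>) x = \<infinity>} =
      1 - measure M {\<omega> \<in> space M. Y 0 \<omega> = x \<and> (\<exists>k. Y (Suc k) \<omega> = x)}"
proof -
  from M obtain Y S where chain: "jump_chain M (jump_prob r) x Y"
    and S: "\<And>n. S n \<in> borel_measurable M"
    and path: "\<And>\<omega>. \<omega> \<in> space M \<Longrightarrow> jump_path (\<lambda>n. Y n \<omega>) (\<lambda>n. S n \<omega>) (\<lambda>t. X t \<omega>)"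
    and joint_law: "jump_holding_law r x M Y S"
    by (rule markov_fromE) blast
  interpret jump_chain M "jump_prob r" x Y by (rule chain)
  have pos: "0 < S n \<omega>" if "\<omega> \<in> space M" for n \<omega>
    using path[OF that] by (simp add: jump_path_def)
  have "jump_prob r x x = 0"
    using diag rate[of x] by (simp add: jump_prob_def)
  then have "AE \<omega> in M. Y (Suc 0) \<omega> \<noteq> x"
    by (rule AE_first_jump)
  moreover have "AE \<omega> in M. \<forall>n. S n \<omega> < \<infinity>"
    by (rule AE_holding_time_finite[OF chain S joint_law rate pos])
  ultimately have "AE \<omega> in M.
      (\<omega> \<in> {\<omega> \<in> space M. (\<exists>t\<ge>0. X t \<omega> \<noteq> Some x) \<and> return_time (\<lambda>t. X t \<omega>) x = \<infinity>}) =
      (\<omega> \<in> {\<omega> \<in> space M. \<forall>k. Y (Suc k) \<omega> \<noteq> x})"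
    using AE_start AE_space
  proof eventually_elim
    case (elim \<omega>)
    have fin: "(\<Sum>i<n. S i \<omega>) < \<infinity>" for n
      using elim(2) by simp
    have "(\<exists>t\<ge>0. X t \<omega> \<noteq> Some x)"
      unfolding path_leaves_iff[OF path[OF elim(4)]] using fin elim(1) by blast
    moreover have "return_time (\<lambda>t. X t \<omega>) x = \<infinity> \<longleftrightarrow> (\<forall>k. Y (Suc k) \<omega> \<noteq> x)"
      unfolding return_time_infinite_iff[OF path[OF elim(4)]]
    proof
      assume no_return: "\<not> (\<exists>m n. m < n \<and> (\<Sum>i<n. S i \<omega>) < \<infinity> \<and> Y n \<omega> = x \<and> Y m \<omega> \<noteq> x)"
      show "\<forall>k. Y (Suc k) \<omega> \<noteq> x"
      proof (intro allI notI)
        fix k assume k: "Y (Suc k) \<omega> = x"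
        with elim(1) have "k \<noteq> 0"
          by metis
        \<comment> \<open>The chain is off \<open>x\<close> at index 1, so the indices 1 and
          \<open>Suc k\<close> witness a return.\<close>
        then have "Suc 0 < Suc k"
          by simp
        then show False
          using no_return fin k elim(1) by blast
      qed
    next
      assume "\<forall>k. Y (Suc k) \<omega> \<noteq> x"
      then show "\<not> (\<exists>m n. m < n \<and> (\<Sum>i<n. S i \<omega>) < \<infinity> \<and> Y n \<omega> = x \<and> Y m \<omega> \<noteq> x)"
        by (metis not_less_zero old.nat.exhaust)
    qed
    ultimately show ?case
      using elim(4) by blast
  qed
  moreover have "{\<omega> \<in> space M. (\<exists>t\<ge>0. X t \<omega> \<noteq> Some x) \<and> return_time (\<lambda>t. X t \<omega>) x = \<infinity>} \<in> events"
    by (rule escape_event_measurable[OF Y_measurable S path])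
  moreover have "{\<omega> \<in> space M. \<forall>k. Y (Suc k) \<omega> \<noteq> x} \<in> events"
    by measurable
  ultimately have "prob {\<omega> \<in> space M. (\<exists>t\<ge>0. X t \<omega> \<noteq> Some x) \<and> return_time (\<lambda>t. X t \<omega>) x = \<infinity>} =
      prob {\<omega> \<in> space M. \<forall>k. Y (Suc k) \<omega> \<noteq> x}"
    by (rule measure_eq_AE)
  then show thesis
    using that[OF chain] prob_escape by simp
qed

text \<open>With rate 0 the first holding time exceeds every integer almost surely, so it is
  infinite and the path never leaves \<open>x\<close>. This serves to exclude vanishing holding
  rates.\<close>

lemma absorbing_not_transient:
  fixes r :: "'e::countable \<Rightarrow> 'e \<Rightarrow> real"
  assumes M: "markov_from r x M X" and rate: "holding_rate r x = 0" and single: "\<And>z. z = x"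
  shows "measure M {\<omega> \<in> space M. (\<exists>t\<ge>0. X t \<omega> \<noteq> Some x) \<and> return_time (\<lambda>t. X t \<omega>) x = \<infinity>} = 0"
proof -
  from M obtain Y S where chain: "jump_chain M (jump_prob r) x Y"
    and S [measurable]: "\<And>n. S n \<in> borel_measurable M"
    and path: "\<And>\<omega>. \<omega> \<in> space M \<Longrightarrow> jump_path (\<lambda>n. Y n \<omega>) (\<lambda>n. S n \<omega>) (\<lambda>t. X t \<omega>)"
    and joint_law: "jump_holding_law r x M Y S"
    by (rule markov_fromE) blast
  interpret jump_chain M "jump_prob r" x Y by (rule chain)
  have "AE \<omega> in M. ennreal (real k) < S 0 \<omega>" for k
  proof -
    have "prob {\<omega> \<in> space M. \<forall>i\<le>0. Y i \<omega> = x \<and> ennreal (real k) < S i \<omega>} = 1"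
      using jump_holding_lawD[OF joint_law, of "\<lambda>_. real k" 0 "\<lambda>_. x"] by (simp add: rate)
    then have "AE \<omega> in M. \<forall>i\<le>0. Y i \<omega> = x \<and> ennreal (real k) < S i \<omega>"
      by (subst (asm) prob_Collect_eq_1) measurable
    then show ?thesis
      by eventually_elim simp
  qed
  then have "AE \<omega> in M. \<forall>k. ennreal (real k) < S 0 \<omega>"
    by (simp only: AE_all_countable simp_thms)
  then have "AE \<omega> in M. \<not> ((\<exists>t\<ge>0. X t \<omega> \<noteq> Some x) \<and> return_time (\<lambda>t. X t \<omega>) x = \<infinity>)"
    using AE_space
  proof eventually_elim
    case (elim \<omega>)
    have "S 0 \<omega> = \<infinity>"
    proof (rule ccontr)
      assume "S 0 \<omega> \<noteq> \<infinity>"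
      then obtain k where "S 0 \<omega> < of_nat k"
        using ennreal_Ex_less_of_nat[of "S 0 \<omega>"] by (auto simp: less_top)
      with elim(1) show False
        by (metis ennreal_of_nat_eq_real_of_nat less_asym)
    qed
    then have "(\<Sum>i<Suc 0. S i \<omega>) = \<infinity>"
      by simp
    \<comment> \<open>This rules out explosion; leaving by a jump is impossible as \<open>x\<close>
      is the only state.\<close>
    then have "(SUP n. \<Sum>i<n. S i \<omega>) = \<infinity>"
      using SUP_upper[of "Suc 0" UNIV "\<lambda>n. \<Sum>i<n. S i \<omega>"] by (simp add: top_unique)
    then have "\<not> (SUP n. \<Sum>i<n. S i \<omega>) < \<infinity>"
      by (simp only: less_irrefl not_False_eq_True)
    then have "\<not> (\<exists>t\<ge>0. X t \<omega> \<noteq> Some x)"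
      unfolding path_leaves_iff[OF path[OF elim(2)]] using single by blast
    then show ?case by blast
  qed
  then show ?thesis
    using escape_event_measurable[OF Y_measurable S path] by (subst prob_Collect_eq_0) auto
qed

section \<open>The symmetric version\<close>

lemma holding_rate_has_sum: "jump_rates r \<Longrightarrow> (r x has_sum holding_rate r x) UNIV"
  unfolding holding_rate_def jump_rates_def by (intro has_sum_infsum) auto

lemma sum_le_holding_rate:
  assumes "jump_rates r" "finite F"
  shows "(\<Sum>z\<in>F. r y z) \<le> holding_rate r y"
  unfolding holding_rate_def using assms by (intro finite_sum_le_infsum) (auto simp: jump_rates_def)

lemma jump_prob_nonneg:
  assumes "jump_rates r"
  shows "0 \<le> jump_prob r y z"
  using assms sum_le_holding_rate[OF assms, of "{}" y] by (auto simp: jump_prob_def jump_rates_def)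

lemma sum_jump_prob_le_1:
  assumes "jump_rates r" "0 < holding_rate r y" "finite F"
  shows "(\<Sum>z\<in>F. jump_prob r y z) \<le> 1"
  using sum_le_holding_rate[OF assms(1,3), of y] assms(2)
  by (simp add: jump_prob_def flip: sum_divide_distrib)

text \<open>A nonempty path of positive rates from \<open>x\<close> to \<open>z\<close> would start
  with a positive rate out of \<open>x\<close>, but all of those are bounded by the holding
  rate.\<close>

lemma irreducible_absorbing_singleton:
  assumes r: "jump_rates r" and irr: "irreducible_rates r" and "holding_rate r x \<le> 0"
  shows "z = x"
proof -
  have zero: "r x y \<le> 0" for y
    using sum_le_holding_rate[OF r, of "{y}" x] assms(3) by simp
  have "(\<lambda>a b. 0 < r a b)\<^sup>*\<^sup>* x z"
    using irr by (simp add: irreducible_rates_def)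
  then show ?thesis
    by (cases rule: converse_rtranclpE) (use zero in \<open>auto simp: not_less[symmetric]\<close>)
qed

text \<open>Stationarity divided by \<open>\<mu> x\<close> says that the adjoint rates out of
  \<open>x\<close> also sum to \<open>holding_rate r x\<close>; averaging preserves this
  total.\<close>

lemma symmetric_rate_has_sum:
  assumes r: "jump_rates r" and \<mu>: "stationary_measure r \<mu>"
  shows "(symmetric_rate \<mu> r x has_sum holding_rate r x) UNIV"
proof -
  have "((\<lambda>y. (r x y + inverse (\<mu> x) * (\<mu> y * r y x)) * (1 / 2)) has_sum
      (holding_rate r x + inverse (\<mu> x) * (\<mu> x * holding_rate r x)) * (1 / 2)) UNIV"
    using \<mu> holding_rate_has_sum[OF r, of x] unfolding stationary_measure_def
    by (intro has_sum_cmult_left has_sum_add has_sum_cmult_right) auto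
  moreover have "\<mu> x \<noteq> 0"
    using \<mu> by (metis less_irrefl stationary_measure_def)
  ultimately show ?thesis
    by (simp add: symmetric_rate_def[abs_def] adjoint_rate_def field_simps)
qed

lemma holding_rate_symmetric:
  assumes "jump_rates r" "stationary_measure r \<mu>"
  shows "holding_rate (symmetric_rate \<mu> r) x = holding_rate r x"
  unfolding holding_rate_def[of "symmetric_rate \<mu> r"]
  using symmetric_rate_has_sum[OF assms] by (rule infsumI)

lemma jump_rates_symmetric:
  assumes "jump_rates r" "stationary_measure r \<mu>"
  shows "jump_rates (symmetric_rate \<mu> r)"
  unfolding jump_rates_def
proof (intro conjI allI)
  fix x y
  have "0 \<le> \<mu> z" for z
    using assms(2) by (simp add: stationary_measure_def less_imp_le)
  with assms(1) show "0 \<le> symmetric_rate \<mu> r x y" "symmetric_rate \<mu> r x x = 0"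
    by (simp_all add: jump_rates_def symmetric_rate_def adjoint_rate_def)
  show "symmetric_rate \<mu> r x summable_on UNIV"
    using symmetric_rate_has_sum[OF assms] by (rule has_sum_imp_summable)
qed

text \<open>Since both chains have the same holding rates, both return probabilities become sums
  over rates after multiplication by the common factor \<open>\<mu> x * holding_rate r x\<close>,
  and \<open>symmetrization_return_le\<close> applies.\<close>

lemma return_prob_le_symmetric:
  assumes r: "jump_rates r" and \<mu>: "stationary_measure r \<mu>"
    and rate: "\<And>z. 0 < holding_rate r z" and F: "finite F" "x \<in> F"
  defines "p \<equiv> jump_prob r" and "ps \<equiv> jump_prob (symmetric_rate \<mu> r)"
  shows "(\<Sum>z\<in>F. p x z * hit_prob p F x z) \<le> (\<Sum>z\<in>F. ps x z * hit_prob ps F x z)"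
proof -
  let ?s = "symmetric_rate \<mu> r"
  have s: "jump_rates ?s" and s_rate: "holding_rate ?s z = holding_rate r z" for z
    using r \<mu> by (rule jump_rates_symmetric holding_rate_symmetric)+
  have \<mu>_pos: "0 < \<mu> z" for z
    using \<mu> by (simp add: stationary_measure_def)
  have p: "0 \<le> p y z" "(\<Sum>z\<in>F. p y z) \<le> 1" and ps: "0 \<le> ps y z" "(\<Sum>z\<in>F. ps y z) \<le> 1" for y z
    using r s rate s_rate F unfolding p_def ps_def
    by (simp_all add: jump_prob_nonneg sum_jump_prob_le_1)
  have p_eq: "\<mu> y * r y z = \<mu> y * holding_rate r y * p y z"
    and ps_eq: "\<mu> y * ?s y z = \<mu> y * holding_rate r y * ps y z" for y z
    using rate[of y] by (simp_all add: p_def ps_def jump_prob_def s_rate)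
  have "(\<Sum>z\<in>F. \<mu> x * r x z * hit_prob p F x z) \<le> (\<Sum>z\<in>F. \<mu> x * ?s x z * hit_prob ps F x z)"
  proof (rule symmetrization_return_le[where d = "\<lambda>y. \<mu> y * holding_rate r y"
        and a = "\<lambda>y z. \<mu> y * r y z" and b = "\<lambda>y z. \<mu> y * ?s y z"])
    show "0 \<le> \<mu> y * r y z" for y z
      using r \<mu>_pos[of y] by (simp add: jump_rates_def)
    show "(\<Sum>z\<in>F. \<mu> y * r y z) \<le> \<mu> y * holding_rate r y" for y
      using sum_le_holding_rate[OF r F(1)] \<mu>_pos[of y] by (simp flip: sum_distrib_left)
    \<comment> \<open>The column bound is a partial sum of the stationarity equation at
      \<open>z\<close>.\<close>
    show "(\<Sum>y\<in>F. \<mu> y * r y z) \<le> \<mu> z * holding_rate r z" for z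
    proof -
      have sum: "((\<lambda>y. \<mu> y * r y z) has_sum (\<mu> z * holding_rate r z)) UNIV"
        using \<mu> by (simp add: stationary_measure_def)
      have "(\<Sum>y\<in>F. \<mu> y * r y z) \<le> (\<Sum>\<^sub>\<infinity>y. \<mu> y * r y z)"
        using r \<mu>_pos F(1) has_sum_imp_summable[OF sum]
        by (intro finite_sum_le_infsum) (auto simp: jump_rates_def less_imp_le)
      then show ?thesis
        by (simp add: infsumI[OF sum])
    qed
    show "\<mu> y * ?s y z = (\<mu> y * r y z + \<mu> z * r z y) / 2" for y z
      using \<mu>_pos[of y] by (simp add: symmetric_rate_def adjoint_rate_def field_simps)
    show "hit_prob p F x x = 1" "hit_prob ps F x x = 1"
      by (rule hit_prob_self; fact p ps)+
    fix y assume y: "y \<in> F" "y \<noteq> x"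
    show "\<mu> y * holding_rate r y * hit_prob p F x y = (\<Sum>z\<in>F. \<mu> y * r y z * hit_prob p F x z)"
      by (subst hit_prob_harmonic[OF p y]) (simp add: p_eq sum_distrib_left mult.assoc)
    show "\<mu> y * holding_rate r y * hit_prob ps F x y = (\<Sum>z\<in>F. \<mu> y * ?s y z * hit_prob ps F x z)"
      by (subst hit_prob_harmonic[OF ps y]) (simp add: ps_eq sum_distrib_left mult.assoc)
  qed fact+
  then have "\<mu> x * holding_rate r x * (\<Sum>z\<in>F. p x z * hit_prob p F x z) \<le>
      \<mu> x * holding_rate r x * (\<Sum>z\<in>F. ps x z * hit_prob ps F x z)"
    by (simp add: p_eq ps_eq sum_distrib_left mult.assoc)
  then show ?thesis
    using \<mu>_pos[of x] rate[of x] by simp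
qed

section \<open>Transfer of transience\<close>

theorem lemma5p1:
  fixes r :: "'e::countable \<Rightarrow> 'e \<Rightarrow> real"
    and \<mu> :: "'e \<Rightarrow> real"
    and P :: "'e \<Rightarrow> 'w measure" and X :: "real \<Rightarrow> 'w \<Rightarrow> 'e option"
    and Ps :: "'e \<Rightarrow> 'v measure" and Xs :: "real \<Rightarrow> 'v \<Rightarrow> 'e option"
  assumes "jump_rates r"
    and "irreducible_rates r"
    and "stationary_measure r \<mu>"
    and "markov_process r P X"
    and "non_explosive P X"
    and "markov_process (symmetric_rate \<mu> r) Ps Xs"
    and "transient Ps Xs"
  shows "transient P X"
  unfolding transient_def
proof
  fix x
  let ?s = "symmetric_rate \<mu> r"
  note r = assms(1) and \<mu> = assms(3)
  have s: "jump_rates ?s" and s_rate: "holding_rate ?s z = holding_rate r z" for z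
    using r \<mu> by (rule jump_rates_symmetric holding_rate_symmetric)+
  have M: "markov_from r x (P x) X" and Ms: "markov_from ?s x (Ps x) Xs" for x
    using assms(4,6) by (simp_all add: markov_process_def)
  have trans: "0 < measure (Ps x) {\<omega> \<in> space (Ps x).
      (\<exists>t\<ge>0. Xs t \<omega> \<noteq> Some x) \<and> return_time (\<lambda>t. Xs t \<omega>) x = \<infinity>}" for x
    using assms(7) by (simp add: transient_def)
  \<comment> \<open>An absorbing state would be the only state, and the symmetric process, having
    the same holding rates, would stay there, contrary to its transience.\<close>
  have rate: "0 < holding_rate r z" for z
  proof (rule ccontr)
    assume "\<not> 0 < holding_rate r z"
    then have "holding_rate r z = 0" and single: "w = z" for w
      using sum_le_holding_rate[OF r, of "{}" z] irreducible_absorbing_singleton[OF r assms(2)]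
      by auto
    then show False
      using absorbing_not_transient[OF Ms, of z] trans[of z] s_rate[of z] by simp
  qed
  have diag: "r x x = 0" "?s x x = 0"
    using r s by (simp_all add: jump_rates_def)
  from M rate diag(1) obtain Y where Y: "jump_chain (P x) (jump_prob r) x Y"
    and escape: "measure (P x) {\<omega> \<in> space (P x).
        (\<exists>t\<ge>0. X t \<omega> \<noteq> Some x) \<and> return_time (\<lambda>t. X t \<omega>) x = \<infinity>} =
      1 - measure (P x) {\<omega> \<in> space (P x). Y 0 \<omega> = x \<and> (\<exists>k. Y (Suc k) \<omega> = x)}"
    by (rule prob_escape_eq)
  have s_rate_pos: "0 < holding_rate ?s z" for z
    by (simp add: s_rate rate)
  from Ms s_rate_pos diag(2) obtain Ys where Ys: "jump_chain (Ps x) (jump_prob ?s) x Ys"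
    and escape_s: "measure (Ps x) {\<omega> \<in> space (Ps x).
        (\<exists>t\<ge>0. Xs t \<omega> \<noteq> Some x) \<and> return_time (\<lambda>t. Xs t \<omega>) x = \<infinity>} =
      1 - measure (Ps x) {\<omega> \<in> space (Ps x). Ys 0 \<omega> = x \<and> (\<exists>k. Ys (Suc k) \<omega> = x)}"
    by (rule prob_escape_eq)
  have "measure (P x) {\<omega> \<in> space (P x). Y 0 \<omega> = x \<and> (\<exists>k. Y (Suc k) \<omega> = x)} \<le>
    measure (Ps x) {\<omega> \<in> space (Ps x). Ys 0 \<omega> = x \<and> (\<exists>k. Ys (Suc k) \<omega> = x)}"
  proof (rule jump_chain.prob_return_le[OF Y])
    fix F :: "'e set" and n
    assume F: "finite F" "x \<in> F"
    let ?p = "jump_prob r" and ?ps = "jump_prob ?s"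
    have p: "0 \<le> ?p y z" "(\<Sum>z\<in>F. ?p y z) \<le> 1"
      and ps: "0 \<le> ?ps y z" "(\<Sum>z\<in>F. ?ps y z) \<le> 1" for y z
      using r s rate s_rate_pos F by (simp_all add: jump_prob_nonneg sum_jump_prob_le_1)
    \<comment> \<open>For fixed \<open>F\<close>: pass from \<open>n\<close> steps to the limit,
      symmetrize there, and return to finite horizons, where the sums are bounded by the full return
      probability of the symmetric chain.\<close>
    have "(\<Sum>z\<in>F. ?p x z * hit_within ?p F x n z) \<le> (\<Sum>z\<in>F. ?p x z * hit_prob ?p F x z)"
      by (intro sum_mono mult_left_mono hit_within_le_hit_prob p)
    also have "\<dots> \<le> (\<Sum>z\<in>F. ?ps x z * hit_prob ?ps F x z)"
      by (rule return_prob_le_symmetric[OF r \<mu> rate F])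
    also have "\<dots> \<le> measure (Ps x) {\<omega> \<in> space (Ps x). Ys 0 \<omega> = x \<and> (\<exists>k. Ys (Suc k) \<omega> = x)}"
    proof (rule LIMSEQ_le_const2)
      show "(\<lambda>n. \<Sum>z\<in>F. ?ps x z * hit_within ?ps F x n z) \<longlonglongrightarrow> (\<Sum>z\<in>F. ?ps x z * hit_prob ?ps F x z)"
        by (intro tendsto_intros hit_within_tendsto ps)
      show "\<exists>N. \<forall>n\<ge>N. (\<Sum>z\<in>F. ?ps x z * hit_within ?ps F x n z) \<le>
          measure (Ps x) {\<omega> \<in> space (Ps x). Ys 0 \<omega> = x \<and> (\<exists>k. Ys (Suc k) \<omega> = x)}"
        using jump_chain.return_within_le_prob_return[OF Ys F] by blast
    qed
    finally show "(\<Sum>z\<in>F. ?p x z * hit_within ?p F x n z) \<le>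
      measure (Ps x) {\<omega> \<in> space (Ps x). Ys 0 \<omega> = x \<and> (\<exists>k. Ys (Suc k) \<omega> = x)}" .
  qed
  then show "0 < measure (P x) {\<omega> \<in> space (P x).
      (\<exists>t\<ge>0. X t \<omega> \<noteq> Some x) \<and> return_time (\<lambda>t. X t \<omega>) x = \<infinity>}"
    using trans[of x] unfolding escape escape_s by simp
qed

end
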